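(* Let $V,W\subset X$ be $p$-dimensional oriented subspaces. Then $$\cos\mathbf{\Theta}_{V,W} = \sum_{I\in\mathcal I_p^n} \cos\mathbf{\Theta}_{V,X_I}\, \cos\mathbf{\Theta}_{W,X_I},$$ where $n=\dim X$ and the $X_I$'s are the coordinate $p$-subspaces of an orthogonal basis of $X$, with orientations given by the corresponding coordinate $p$-blades.
   Context: $X$ is an $n$-dimensional vector space over $\mathbb{R}$ (real case) or $\mathbb{C}$ (complex case) with inner product $\langle\cdot,\cdot\rangle$ (Hermitian in the complex case, conjugate-linear in the first argument). Blades: a $p$-blade is a simple multivector $\nu=v_1\wedge\cdots\wedge v_p\in\Lambda^pX$; if $\nu\neq0$ it represents the $p$-dimensional subspace $V=\mathrm{span}(v_1,\ldots,v_p)$. Scalars in $\Lambda^0X$ are $0$-blades, representing $\{0\}$. $\Lambda X$ has the inner product given on $p$-blades by $\langle v_1\wedge\cdots\wedge v_p,\,w_1\wedge\cdots\wedge w_p\rangle=\det(\langle v_i,w_j\rangle)$ (and by $\langle\nu,\omega\rangle=\bar\nu\omega$ on scalars), extended linearly (sesquilinearly in the complex case), with distinct grades orthogonal; $\|\nu\|=\sqrt{\langle\nu,\nu\rangle}$. Grassmann angle: for subspaces $V,W\subset X$, let $P$ be the orthogonal projection of $X$ onto $W$, acting on blades by $P(v_1\wedge\cdots\wedge v_p)=Pv_1\wedge\cdots\wedge Pv_p$ (identity on scalars). The Grassmann angle $\Theta_{V,W}\in[0,\frac\pi2]$ is defined by $\cos\Theta_{V,W}=\|P\nu\|/\|\nu\|$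 for any nonzero blade $\nu$ representing $V$. Oriented version: for $p$-dimensional subspaces $V,W$ with orientations given by blades $\nu,\omega\in\Lambda^pX$ representing them, the Grassmann angle $\mathbf\Theta_{V,W}$ for oriented subspaces is given by $\cos\mathbf\Theta_{V,W}=\frac{\langle\nu,\omega\rangle}{|\langle\nu,\omega\rangle|}\cos\Theta_{V,W}$ if $\langle\nu,\omega\rangle\ne0$, and $\mathbf\Theta_{V,W}=\frac\pi2$ otherwise. Multi-indices: for $1\le p\le n$, $\mathcal I_p^n=\{(i_1,\ldots,i_p)\in\mathbb N^p:1\le i_1<\cdots<i_p\le n\}$, and $\mathcal I_0^n=\{0\}$. Given a basis $(x_1,\ldots,x_n)$ of $X$, its coordinate $p$-subspaces are $X_I=\mathrm{span}(x_{i_1},\ldots,x_{i_p})$ and its coordinate $p$-blades are $x_{i_1}\wedge\cdots\wedge x_{i_p}$, for $I=(i_1,\ldots,i_p)\in\mathcal I_p^n$; for $p=0$ these are $\{0\}$ and $1$.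
   Formalization: In the complex case the second factor cos Θ_{W,X_I} is replaced by its complex conjugate, since the printed formula fails there (X=V=W=ℂ, both oriented by 1, basis vector i: left side 1, right side −1); the real case is as printed. *)

theory Defs
  imports Complex_Main "HOL-Library.Poly_Mapping" "Jordan_Normal_Form.Determinant"
    "Jordan_Normal_Form.Conjugate"
begin

text \<open>
  The real and the complex case are developed together over a scalar type \<open>'k\<close>, which is later
  taken to be \<^typ>\<open>real\<close> (where \<^const>\<open>conjugate\<close> is the identity) or \<^typ>\<open>complex\<close> (where it
  is \<^const>\<open>cnj\<close>).  The whole type \<open>'a\<close> plays the role of \<open>X\<close>.
\<close>

type_synonym ('k, 'a) combination = "'a list \<Rightarrow>\<^sub>0 'k"
type_synonym ('k, 'a) multivector = "('k, 'a) combination set"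
type_synonym ('k, 'a) oriented_subspace = "'a set \<times> ('k, 'a) multivector"

locale inner_product_space = vector_space scale
  for scale :: "'k::{conjugatable_field,real_normed_field,banach} \<Rightarrow> 'a::ab_group_add \<Rightarrow> 'a"
    (infixr \<open>*s\<close> 75) +
  fixes ip :: "'a \<Rightarrow> 'a \<Rightarrow> 'k"
  assumes finite_dim: "\<exists>B. finite B \<and> span B = UNIV"
    and ip_add_right: "ip x (y + z) = ip x y + ip x z"
    and ip_scale_right: "ip x (c *s y) = c * ip x y"
    and ip_commute: "ip y x = conjugate (ip x y)"
    and ip_pos: "x \<noteq> 0 \<Longrightarrow> \<exists>r>0. ip x x = of_real r"
begin

subsection \<open>The exterior algebra\<close>

text \<open>
  \<open>\<Lambda>X\<close> is given by generators and relations: it is the free vector space on all finite lists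
  \<open>[v\<^sub>1, \<dots>, v\<^sub>p]\<close> modulo the subspace below, which makes the class of \<open>[v\<^sub>1, \<dots>, v\<^sub>p]\<close> multilinear and
  alternating.  That class is \<open>v\<^sub>1 \<and> \<dots> \<and> v\<^sub>p\<close>; the empty list gives the scalar 1, and a multivector
  is a coset.
\<close>

inductive_set wedge_relations :: "('k, 'a) combination set" where
  zero: "0 \<in> wedge_relations"
| add: "f \<in> wedge_relations \<Longrightarrow> g \<in> wedge_relations \<Longrightarrow> f + g \<in> wedge_relations"
| scale: "f \<in> wedge_relations \<Longrightarrow> Poly_Mapping.map ((*) c) f \<in> wedge_relations"
| additive: "Poly_Mapping.single (us @ (v + w) # ws) 1 - Poly_Mapping.single (us @ v # ws) 1
     - Poly_Mapping.single (us @ w # ws) 1 \<in> wedge_relations"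
| homogeneous: "Poly_Mapping.single (us @ (c *s v) # ws) 1 - Poly_Mapping.single (us @ v # ws) c
     \<in> wedge_relations"
| alternating: "Poly_Mapping.single (us @ v # vs @ v # ws) 1 \<in> wedge_relations"

definition multivector_of :: "('k, 'a) combination \<Rightarrow> ('k, 'a) multivector" where
  "multivector_of f = {g. g - f \<in> wedge_relations}"

definition mv_zero :: "('k, 'a) multivector" where
  "mv_zero = multivector_of 0"

definition mv_scalar :: "'k \<Rightarrow> ('k, 'a) multivector" where
  "mv_scalar c = multivector_of (Poly_Mapping.single [] c)"

definition wedge :: "'a list \<Rightarrow> ('k, 'a) multivector" where
  "wedge vs = multivector_of (Poly_Mapping.single vs 1)"

text \<open>For \<open>p = 0\<close> the determinant is 1, so the scalars carry \<open>\<langle>\<nu>, \<omega>\<rangle> = conjugate \<nu> * \<omega>\<close>.\<close>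

definition gram :: "'a list \<Rightarrow> 'a list \<Rightarrow> 'k" where
  "gram vs ws = (if length vs = length ws
     then det (mat (length vs) (length vs) (\<lambda>(i, j). ip (vs ! i) (ws ! j))) else 0)"

definition combination_ip :: "('k, 'a) combination \<Rightarrow> ('k, 'a) combination \<Rightarrow> 'k" where
  "combination_ip f g = (\<Sum>vs\<in>Poly_Mapping.keys f. \<Sum>ws\<in>Poly_Mapping.keys g.
     conjugate (Poly_Mapping.lookup f vs) * Poly_Mapping.lookup g ws * gram vs ws)"

text \<open>Independence of the representatives is shown in \<open>mv_ip_multivector_of\<close> below.\<close>

definition mv_ip :: "('k, 'a) multivector \<Rightarrow> ('k, 'a) multivector \<Rightarrow> 'k" where
  "mv_ip \<nu> \<omega> = (THE c. \<forall>f\<in>\<nu>. \<forall>g\<in>\<omega>. c = combination_ip f g)"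

text \<open>\<open>mv_ip \<nu> \<nu>\<close> is a nonnegative real element of \<open>'k\<close>, so \<open>norm\<close> only changes its type.\<close>

definition mv_norm :: "('k, 'a) multivector \<Rightarrow> real" where
  "mv_norm \<nu> = sqrt (norm (mv_ip \<nu> \<nu>))"

definition combination_map :: "('a \<Rightarrow> 'a) \<Rightarrow> ('k, 'a) combination \<Rightarrow> ('k, 'a) combination" where
  "combination_map T f =
     (\<Sum>vs\<in>Poly_Mapping.keys f. Poly_Mapping.single (map T vs) (Poly_Mapping.lookup f vs))"

text \<open>
  The action of a linear map on multivectors, \<open>v\<^sub>1 \<and> \<dots> \<and> v\<^sub>p \<mapsto> T v\<^sub>1 \<and> \<dots> \<and> T v\<^sub>p\<close>; independence of
  the representative is shown in \<open>mv_map_multivector_of\<close>.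
\<close>

definition mv_map :: "('a \<Rightarrow> 'a) \<Rightarrow> ('k, 'a) multivector \<Rightarrow> ('k, 'a) multivector" where
  "mv_map T \<nu> = (THE \<mu>. \<forall>f\<in>\<nu>. \<mu> = multivector_of (combination_map T f))"

definition represents :: "('k, 'a) multivector \<Rightarrow> 'a set \<Rightarrow> bool" where
  "represents \<nu> V \<longleftrightarrow> \<nu> \<noteq> mv_zero \<and>
     ((\<exists>vs. vs \<noteq> [] \<and> \<nu> = wedge vs \<and> V = span (set vs)) \<or> (\<exists>c. \<nu> = mv_scalar c \<and> V = {0}))"

subsection \<open>Grassmann angles\<close>

definition orth_proj :: "'a set \<Rightarrow> 'a \<Rightarrow> 'a" where
  "orth_proj W x = (THE y. y \<in> W \<and> (\<forall>w\<in>W. ip w (x - y) = 0))"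

definition grassmann_angle :: "'a set \<Rightarrow> 'a set \<Rightarrow> real" where
  "grassmann_angle V W = (THE \<theta>. 0 \<le> \<theta> \<and> \<theta> \<le> pi / 2 \<and>
     (\<forall>\<nu>. represents \<nu> V \<longrightarrow> cos \<theta> = mv_norm (mv_map (orth_proj W) \<nu>) / mv_norm \<nu>))"

definition oriented_subspace :: "nat \<Rightarrow> ('k, 'a) oriented_subspace \<Rightarrow> bool" where
  "oriented_subspace p S \<longleftrightarrow> subspace (fst S) \<and> dim (fst S) = p \<and> represents (snd S) (fst S)"

text \<open>
  The angle is prescribed only through its cosine, which is a number of \<open>'k\<close>; in the complex case
  both the cosine and the angle may be non-real.  \<open>SOME\<close> picks any angle with that cosine.
  Over \<^typ>\<open>complex\<close>, interchanging the two subspaces conjugates the cosine, and changing the phase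
  of the second orientation multiplies the cosine by that phase.  A sum of products of cosines
  with respect to two subspaces can thus be independent of the phases of the coordinate blades only
  if one of the two factors is conjugated.
\<close>

definition oriented_angle ::
  "('k, 'a) oriented_subspace \<Rightarrow> ('k, 'a) oriented_subspace \<Rightarrow> 'k" where
  "oriented_angle S T = (case (S, T) of ((V, \<nu>), (W, \<omega>)) \<Rightarrow>
     if mv_ip \<nu> \<omega> \<noteq> 0
     then SOME \<theta>. cos \<theta> = mv_ip \<nu> \<omega> / of_real (norm (mv_ip \<nu> \<omega>)) * of_real (cos (grassmann_angle V W))
     else of_real (pi / 2))"

subsection \<open>Coordinate subspaces\<close>

definition orthogonal_basis :: "nat \<Rightarrow> (nat \<Rightarrow> 'a) \<Rightarrow> bool" where
  "orthogonal_basis n x \<longleftrightarrow> inj_on x {1..n} \<and> independent (x ` {1..n}) \<and> span (x ` {1..n}) = UNIV \<and>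
     (\<forall>i\<in>{1..n}. \<forall>j\<in>{1..n}. i \<noteq> j \<longrightarrow> ip (x i) (x j) = 0)"

definition coordinate_subspace :: "(nat \<Rightarrow> 'a) \<Rightarrow> nat list \<Rightarrow> ('k, 'a) oriented_subspace" where
  "coordinate_subspace x I = (span (x ` set I), wedge (map x I))"

subsection \<open>Well-definedness of the inner product and of the induced maps\<close>

lemma map_mult_lookup: "Poly_Mapping.lookup (Poly_Mapping.map ((*) c) f) k = (c::'k) * Poly_Mapping.lookup f k"
  by (simp add: Poly_Mapping.map.rep_eq when_def)

lemma combination_ip_superset:
  assumes "finite A" "finite B" "Poly_Mapping.keys f \<subseteq> A" "Poly_Mapping.keys g \<subseteq> B"
  shows "combination_ip f g = (\<Sum>vs\<in>A. \<Sum>ws\<in>B.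
     conjugate (Poly_Mapping.lookup f vs) * Poly_Mapping.lookup g ws * gram vs ws)"
proof -
  let ?F = "\<lambda>vs ws. conjugate (Poly_Mapping.lookup f vs) * Poly_Mapping.lookup g ws * gram vs ws"
  have "combination_ip f g = (\<Sum>vs\<in>Poly_Mapping.keys f. \<Sum>ws\<in>B. ?F vs ws)"
    unfolding combination_ip_def
    by (intro sum.cong refl sum.mono_neutral_left) (use assms in \<open>auto simp: in_keys_iff\<close>)
  also have "\<dots> = (\<Sum>vs\<in>A. \<Sum>ws\<in>B. ?F vs ws)"
    by (intro sum.mono_neutral_left) (use assms in \<open>auto simp: in_keys_iff\<close>)
  finally show ?thesis .
qed

lemma combination_ip_add_right: "combination_ip f (g + h) = combination_ip f g + combination_ip f h"
proof -
  let ?A = "Poly_Mapping.keys f"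
  let ?B = "Poly_Mapping.keys g \<union> Poly_Mapping.keys h"
  have k: "Poly_Mapping.keys (g + h) \<subseteq> ?B"
    by (rule Poly_Mapping.keys_add)
  show ?thesis
    using k by (simp add: combination_ip_superset[of ?A ?B] lookup_add algebra_simps sum.distrib)
qed

lemma combination_ip_scale_right:
  "combination_ip f (Poly_Mapping.map ((*) c) g) = c * combination_ip f g"
proof -
  have "Poly_Mapping.keys (Poly_Mapping.map ((*) c) g) \<subseteq> Poly_Mapping.keys g"
    by (auto simp: in_keys_iff map_mult_lookup)
  then show ?thesis
    by (simp add: combination_ip_superset[of "Poly_Mapping.keys f" "Poly_Mapping.keys g"]
        map_mult_lookup sum_distrib_left algebra_simps)
qed

lemma combination_ip_uminus_right: "combination_ip f (- g) = - combination_ip f g"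
proof -
  have "combination_ip f (- g) + combination_ip f g = combination_ip f (- g + g)"
    by (simp only: combination_ip_add_right)
  also have "\<dots> = 0"
    by (simp add: combination_ip_def)
  finally show ?thesis
    by (simp add: eq_neg_iff_add_eq_0)
qed

lemma combination_ip_diff_right: "combination_ip f (g - h) = combination_ip f g - combination_ip f h"
  using combination_ip_add_right[of f g "- h"] by (simp add: combination_ip_uminus_right)

lemma combination_ip_single_right:
  "combination_ip f (Poly_Mapping.single ws c) = c *
    (\<Sum>vs\<in>Poly_Mapping.keys f. conjugate (Poly_Mapping.lookup f vs) * gram vs ws)"
  by (simp add: combination_ip_superset[of "Poly_Mapping.keys f" "{ws}"] sum_distrib_left algebra_simps)

lemma conjugate_1: "conjugate (1::'k) = 1"
  by (metis conjugate_dist_mul mult.right_neutral conjugate_id mult.left_neutral)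

lemma gram_commute: "gram ws vs = conjugate (gram vs ws)"
proof (cases "length vs = length ws")
  case True
  interpret cj: comm_ring_hom "conjugate :: 'k \<Rightarrow> 'k"
  proof
  qed (simp_all add: conjugate_dist_add conjugate_dist_mul conjugate_1)
  let ?n = "length vs"
  let ?M = "mat ?n ?n (\<lambda>(i, j). ip (vs ! i) (ws ! j))"
  have "mat ?n ?n (\<lambda>(i, j). ip (ws ! i) (vs ! j)) = map_mat conjugate (transpose_mat ?M)"
    by (rule eq_matI) (auto intro: ip_commute)
  then show ?thesis
    using True by (simp add: gram_def det_transpose[of _ ?n])
qed (auto simp: gram_def)

lemma combination_ip_commute: "combination_ip g f = conjugate (combination_ip f g)"
proof -
  have "combination_ip g f = (\<Sum>vs\<in>Poly_Mapping.keys f. \<Sum>ws\<in>Poly_Mapping.keys g.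
     conjugate (Poly_Mapping.lookup g ws) * Poly_Mapping.lookup f vs * gram ws vs)"
    unfolding combination_ip_def by (rule sum.swap)
  also have "\<dots> = (\<Sum>vs\<in>Poly_Mapping.keys f. \<Sum>ws\<in>Poly_Mapping.keys g.
     conjugate (conjugate (Poly_Mapping.lookup f vs) * Poly_Mapping.lookup g ws * gram vs ws))"
    by (intro sum.cong refl) (simp add: conjugate_dist_mul mult.commute flip: gram_commute)
  also have "\<dots> = conjugate (combination_ip f g)"
    unfolding combination_ip_def by (simp add: sum_conjugate)
  finally show ?thesis .
qed

lemma gram_expand:
  assumes "length zs = Suc (length us + length ws)"
  obtains K where "\<And>v. gram zs (us @ v # ws) = (\<Sum>i<length zs. ip (zs ! i) v * K i)"
proof
  fix v
  let ?n = "length zs" and ?k = "length us"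
  let ?M = "\<lambda>v. mat ?n ?n (\<lambda>(i, j). ip (zs ! i) ((us @ v # ws) ! j))"
  have del: "mat_delete (?M v) i ?k = mat_delete (?M 0) i ?k" for i
    by (rule eq_matI) (simp_all add: mat_delete_def nth_append Suc_diff_le)
  have "gram zs (us @ v # ws) = det (?M v)"
    using assms by (simp add: gram_def)
  also have "\<dots> = (\<Sum>i<?n. ?M v $$ (i, ?k) * cofactor (?M v) i ?k)"
    by (rule laplace_expansion_column) (use assms in auto)
  also have "\<dots> = (\<Sum>i<?n. ip (zs ! i) v * cofactor (?M 0) i ?k)"
  proof (rule sum.cong[OF refl])
    fix i assume "i \<in> {..<?n}"
    then have "?M v $$ (i, ?k) = ip (zs ! i) v"
      using assms by simp
    then show "?M v $$ (i, ?k) * cofactor (?M v) i ?k = ip (zs ! i) v * cofactor (?M 0) i ?k"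
      by (simp only: cofactor_def del)
  qed
  finally show "gram zs (us @ v # ws) = (\<Sum>i<?n. ip (zs ! i) v * cofactor (?M 0) i ?k)" .
qed

lemma gram_additive: "gram zs (us @ (v + w) # ws) = gram zs (us @ v # ws) + gram zs (us @ w # ws)"
proof (cases "length zs = Suc (length us + length ws)")
  case True
  then obtain K where "\<And>v. gram zs (us @ v # ws) = (\<Sum>i<length zs. ip (zs ! i) v * K i)"
    by (rule gram_expand) blast
  then show ?thesis
    by (simp add: ip_add_right algebra_simps sum.distrib)
qed (simp add: gram_def)

lemma gram_homogeneous: "gram zs (us @ (c *s v) # ws) = c * gram zs (us @ v # ws)"
proof (cases "length zs = Suc (length us + length ws)")
  case True
  then obtain K where "\<And>v. gram zs (us @ v # ws) = (\<Sum>i<length zs. ip (zs ! i) v * K i)"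
    by (rule gram_expand) blast
  then show ?thesis
    by (simp add: ip_scale_right algebra_simps sum_distrib_left)
qed (simp add: gram_def)

lemma gram_alternating: "gram zs (us @ v # vs @ v # ws) = 0"
proof (cases "length zs = length (us @ v # vs @ v # ws)")
  case True
  let ?n = "length zs" and ?i = "length us" and ?j = "Suc (length us + length vs)"
  let ?M = "mat ?n ?n (\<lambda>(i, j). ip (zs ! i) ((us @ v # vs @ v # ws) ! j))"
  have "det ?M = 0"
  proof (rule det_identical_columns[where n = ?n and i = ?i and j = ?j])
    have "(us @ v # vs @ v # ws) ! ?i = v" "(us @ v # vs @ v # ws) ! ?j = v"
      by (simp_all add: nth_append)
    then show "col ?M ?i = col ?M ?j"
      using True by (intro eq_vecI) simp_all
  qed (use True in auto)
  then show ?thesis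
    using True by (simp add: gram_def)
qed (simp add: gram_def)

lemma combination_ip_relations: "g \<in> wedge_relations \<Longrightarrow> combination_ip f g = 0"
proof (induction rule: wedge_relations.induct)
  case zero
  show ?case by (simp add: combination_ip_def)
next
  case (additive us v w ws)
  show ?case
    by (simp add: combination_ip_diff_right combination_ip_single_right gram_additive
        distrib_left sum.distrib)
next
  case (homogeneous us c v ws)
  show ?case
    by (simp add: combination_ip_diff_right combination_ip_single_right gram_homogeneous
        algebra_simps sum_distrib_left)
qed (simp_all add: combination_ip_add_right combination_ip_scale_right combination_ip_single_right
    gram_alternating)

lemma multivector_of_self: "f \<in> multivector_of f"
  by (simp add: multivector_of_def wedge_relations.zero)

theorem mv_ip_multivector_of: "mv_ip (multivector_of f) (multivector_of g) = combination_ip f g"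
proof -
  have "combination_ip f' g' = combination_ip f g"
    if "f' \<in> multivector_of f" "g' \<in> multivector_of g" for f' g'
  proof -
    have "combination_ip f' (g' - g) = 0"
      using that by (simp add: multivector_of_def combination_ip_relations)
    moreover have "combination_ip g (f' - f) = 0"
      using that by (simp add: multivector_of_def combination_ip_relations)
    ultimately have "combination_ip f' g' = combination_ip f' g" "combination_ip g f' = combination_ip g f"
      by (simp_all add: combination_ip_diff_right)
    then show ?thesis
      by (metis combination_ip_commute)
  qed
  then show ?thesis
    unfolding mv_ip_def by (intro the_equality) (metis multivector_of_self)+
qed

lemma wedge_relations_uminus: "f \<in> wedge_relations \<Longrightarrow> - f \<in> wedge_relations"
proof -
  assume "f \<in> wedge_relations"
  then have "Poly_Mapping.map ((*) (- 1)) f \<in> wedge_relations"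
    by (rule wedge_relations.scale)
  also have "Poly_Mapping.map ((*) (- 1)) f = - f"
    by (rule poly_mapping_eqI) (simp add: map_mult_lookup)
  finally show ?thesis .
qed

lemma multivector_of_eq_iff: "multivector_of f = multivector_of g \<longleftrightarrow> f - g \<in> wedge_relations"
proof
  assume "multivector_of f = multivector_of g"
  then show "f - g \<in> wedge_relations"
    using multivector_of_self[of f] by (simp add: multivector_of_def)
next
  assume fg: "f - g \<in> wedge_relations"
  have "h - f \<in> wedge_relations \<longleftrightarrow> h - g \<in> wedge_relations" for h
  proof
    assume "h - f \<in> wedge_relations"
    from wedge_relations.add[OF this fg] show "h - g \<in> wedge_relations"
      by simp
  next
    assume "h - g \<in> wedge_relations"
    from wedge_relations.add[OF this wedge_relations_uminus[OF fg]] show "h - f \<in> wedge_relations"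
      by simp
  qed
  then show "multivector_of f = multivector_of g"
    by (simp add: multivector_of_def)
qed

lemma combination_map_superset:
  assumes "finite A" "Poly_Mapping.keys f \<subseteq> A"
  shows "combination_map T f =
     (\<Sum>vs\<in>A. Poly_Mapping.single (map T vs) (Poly_Mapping.lookup f vs))"
  unfolding combination_map_def
  by (rule sum.mono_neutral_left) (use assms in \<open>auto simp: in_keys_iff\<close>)

lemma combination_map_add: "combination_map T (f + g) = combination_map T f + combination_map T g"
proof -
  let ?A = "Poly_Mapping.keys f \<union> Poly_Mapping.keys g"
  have "Poly_Mapping.keys (f + g) \<subseteq> ?A"
    by (rule Poly_Mapping.keys_add)
  then show ?thesis
    by (simp add: combination_map_superset[of ?A] lookup_add single_add sum.distrib)
qed

lemma map_mult_add:
  "Poly_Mapping.map ((*) (c::'k)) (f + g) = Poly_Mapping.map ((*) c) f + Poly_Mapping.map ((*) c) g"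
  by (rule poly_mapping_eqI) (simp add: map_mult_lookup lookup_add algebra_simps)

lemma combination_map_scale:
  "combination_map T (Poly_Mapping.map ((*) c) f) = Poly_Mapping.map ((*) c) (combination_map T f)"
proof -
  have sum: "Poly_Mapping.map ((*) c) (sum h A) = (\<Sum>a\<in>A. Poly_Mapping.map ((*) c) (h a))"
    for h :: "'a list \<Rightarrow> ('k, 'a) combination" and A
    by (induction A rule: infinite_finite_induct)
      (auto simp: map_mult_add map_mult_lookup intro: poly_mapping_eqI)
  have sg: "Poly_Mapping.map ((*) c) (Poly_Mapping.single k d) = Poly_Mapping.single k (c * d)"
    for k :: "'a list" and d
    by (rule poly_mapping_eqI) (simp add: map_mult_lookup lookup_single when_def)
  have "Poly_Mapping.keys (Poly_Mapping.map ((*) c) f) \<subseteq> Poly_Mapping.keys f"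
    by (auto simp: in_keys_iff map_mult_lookup)
  then have "combination_map T (Poly_Mapping.map ((*) c) f) =
      (\<Sum>vs\<in>Poly_Mapping.keys f. Poly_Mapping.single (map T vs) (c * Poly_Mapping.lookup f vs))"
    by (simp add: combination_map_superset[of "Poly_Mapping.keys f"] map_mult_lookup)
  also have "\<dots> = Poly_Mapping.map ((*) c) (combination_map T f)"
    by (simp add: combination_map_def sum sg)
  finally show ?thesis .
qed

lemma combination_map_diff: "combination_map T (f - g) = combination_map T f - combination_map T g"
  using combination_map_add[of T "f - g" g] by simp

lemma combination_map_single:
  "combination_map T (Poly_Mapping.single vs c) = Poly_Mapping.single (map T vs) c"
  by (simp add: combination_map_def)

lemma combination_map_relations:
  assumes "Vector_Spaces.linear scale scale T"
  shows "f \<in> wedge_relations \<Longrightarrow> combination_map T f \<in> wedge_relations"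
proof (induction rule: wedge_relations.induct)
  case zero
  show ?case by (simp add: combination_map_def wedge_relations.zero)
next
  interpret T: Vector_Spaces.linear scale scale T by fact
  case (additive us v w ws)
  show ?case
    using wedge_relations.additive[of "map T us" "T v" "T w" "map T ws"]
    by (simp add: combination_map_diff combination_map_single T.add)
next
  interpret T: Vector_Spaces.linear scale scale T by fact
  case (homogeneous us c v ws)
  show ?case
    using wedge_relations.homogeneous[of "map T us" c "T v" "map T ws"]
    by (simp add: combination_map_diff combination_map_single T.scale)
next
  case (alternating us v vs ws)
  show ?case
    using wedge_relations.alternating[of "map T us" "T v" "map T vs" "map T ws"]
    by (simp add: combination_map_single)
qed (simp_all add: combination_map_add combination_map_scale wedge_relations.add wedge_relations.scale)

theorem mv_map_multivector_of:
  assumes "Vector_Spaces.linear scale scale T"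
  shows "mv_map T (multivector_of f) = multivector_of (combination_map T f)"
  unfolding mv_map_def
proof (rule the_equality)
  show "\<forall>g\<in>multivector_of f. multivector_of (combination_map T f) = multivector_of (combination_map T g)"
  proof
    fix g assume "g \<in> multivector_of f"
    then have "- combination_map T (g - f) \<in> wedge_relations"
      by (intro wedge_relations_uminus combination_map_relations[OF assms]) (simp add: multivector_of_def)
    then show "multivector_of (combination_map T f) = multivector_of (combination_map T g)"
      by (simp add: multivector_of_eq_iff combination_map_diff)
  qed
qed (metis multivector_of_self)

corollary mv_map_wedge:
  "Vector_Spaces.linear scale scale T \<Longrightarrow> mv_map T (wedge vs) = wedge (map T vs)"
  by (simp add: wedge_def mv_map_multivector_of combination_map_single)

corollary mv_ip_wedge: "mv_ip (wedge vs) (wedge ws) = gram vs ws"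
  by (simp add: wedge_def mv_ip_multivector_of combination_ip_def conjugate_1)

corollary mv_ip_scalar: "mv_ip (mv_scalar c) (mv_scalar d) = conjugate c * d"
  by (simp add: mv_scalar_def mv_ip_multivector_of combination_ip_def gram_def)

end

text \<open>For \<open>p = 0\<close> the only multi-index is \<open>[]\<close>, giving the subspace \<open>{0}\<close> and the blade 1.\<close>

definition multi_indices :: "nat \<Rightarrow> nat \<Rightarrow> nat list set" where
  "multi_indices p n = {I. length I = p \<and> sorted_wrt (<) I \<and> set I \<subseteq> {1..n}}"

end

theory Submission
  imports "HOL-Analysis.Complex_Transcendental" Defs
begin

text \<open>
  For \<open>p\<close>-blades \<open>\<nu>\<close>, \<open>\<omega>\<close> of the same grade the projection of \<open>\<nu>\<close> onto the subspace \<open>W\<close> of \<open>\<omega>\<close> is a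
  multiple of \<open>\<omega>\<close>, so \<open>\<parallel>P \<nu>\<parallel> \<parallel>\<omega>\<parallel> = |\<langle>\<nu>, \<omega>\<rangle>|\<close>, and the cosine of the oriented angle is
  \<open>\<langle>\<nu>, \<omega>\<rangle> / (\<parallel>\<nu>\<parallel> \<parallel>\<omega>\<parallel>)\<close>.  The coordinate \<open>p\<close>-blades of an orthogonal basis form an orthogonal
  basis of \<open>\<Lambda>\<^sup>pX\<close>, and the claimed identity is the Parseval expansion of \<open>\<langle>\<nu>, \<omega>\<rangle>\<close> in it.
\<close>

no_notation vector_scalar_mult (infixl \<open>*s\<close> 70)
no_notation vec_nth (infixl \<open>$\<close> 90)

section \<open>Alternating forms on lists of vectors\<close>

context inner_product_space
begin

text \<open>The three clauses mirror the generators of \<open>wedge_relations\<close>, so such a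
  form amounts to a linear functional on the exterior algebra, with lists of all lengths treated at
  once.\<close>

definition alternating_form :: "('a list \<Rightarrow> 'k) \<Rightarrow> bool" where
  "alternating_form \<phi> \<longleftrightarrow>
     (\<forall>us v w ws. \<phi> (us @ (v + w) # ws) = \<phi> (us @ v # ws) + \<phi> (us @ w # ws)) \<and>
     (\<forall>us c v ws. \<phi> (us @ (c *s v) # ws) = c * \<phi> (us @ v # ws)) \<and>
     (\<forall>us v vs ws. \<phi> (us @ v # vs @ v # ws) = 0)"

text \<open>Polarisation: the form vanishes on two adjacent copies of \<open>v + w\<close>, and
  expanding leaves only the two mixed terms.\<close>

lemma alternating_form_swap:
  assumes "alternating_form \<phi>"
  shows "\<phi> (us @ v # w # ws) = - \<phi> (us @ w # v # ws)"
proof -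
  have add: "\<phi> (us @ (v + w) # ws) = \<phi> (us @ v # ws) + \<phi> (us @ w # ws)"
    and alt: "\<phi> (us @ v # vs @ v # ws) = 0" for us v w vs ws
    using assms by (auto simp: alternating_form_def)
  have "0 = \<phi> (us @ (v + w) # (v + w) # ws)"
    using alt[of us "v + w" "[]"] by simp
  also have "\<dots> = \<phi> ((us @ [v]) @ (v + w) # ws) + \<phi> ((us @ [w]) @ (v + w) # ws)"
    by (simp add: add)
  also have "\<dots> = \<phi> (us @ v # w # ws) + \<phi> (us @ w # v # ws)"
    using alt[of us v "[]"] alt[of us w "[]"] unfolding add by simp
  finally show ?thesis
    by (simp add: eq_neg_iff_add_eq_0)
qed

text \<open>Insertion is a chain of adjacent swaps; \<open>us\<close> is arbitrary so that the
  induction can move heads into it. The sign is left open because only vanishing is read off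
  later.\<close>

lemma alternating_form_insort:
  fixes a :: "'b::linorder"
  assumes "alternating_form \<phi>"
  shows "\<phi> (us @ map x (insort a J)) = \<phi> (us @ map x (a # J)) \<or>
         \<phi> (us @ map x (insort a J)) = - \<phi> (us @ map x (a # J))"
proof (induction J arbitrary: us)
  case (Cons b J)
  show ?case
    using Cons.IH[of "us @ [x b]"] alternating_form_swap[OF assms, of us "x a" "x b" "map x J"]
    by auto
qed simp

lemma alternating_form_sort:
  fixes I :: "'b::linorder list"
  assumes "alternating_form \<phi>"
  shows "\<phi> (us @ map x (sort I)) = \<phi> (us @ map x I) \<or> \<phi> (us @ map x (sort I)) = - \<phi> (us @ map x I)"
proof (induction I arbitrary: us)
  case (Cons a I)
  show ?case
    using Cons.IH[of "us @ [x a]"] alternating_form_insort[OF assms, of us x a "sort I"] by auto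
qed simp

lemma alternating_form_span_eq_0:
  assumes alt: "alternating_form \<phi>" and "span B = UNIV"
    and B: "\<And>bs. set bs \<subseteq> B \<Longrightarrow> \<phi> bs = 0"
  shows "\<phi> vs = 0"
proof -
  \<comment> \<open>The entries are expanded from the last to the first; those already replaced by
    elements of \<open>B\<close> collect in the suffix \<open>bs\<close>.\<close>
  have "\<phi> (vs @ bs) = 0" if "set bs \<subseteq> B" for bs
    using that
  proof (induction vs arbitrary: bs rule: rev_induct)
    case (snoc v vs)
    have "v \<in> span B"
      using assms by simp
    then have "\<phi> (vs @ v # bs) = 0"
    proof (induction rule: span_induct_alt)
      case base
      have "\<phi> (vs @ (0 *s 0) # bs) = 0 * \<phi> (vs @ 0 # bs)"
        using alt unfolding alternating_form_def by blast
      then show ?case by simp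
    next
      case (step c b y)
      then have "\<phi> (vs @ b # bs) = 0"
        using snoc by simp
      then show ?case
        using alt step by (simp add: alternating_form_def)
    qed
    then show ?case by simp
  qed (simp add: B)
  from this[of "[]"] show ?thesis by simp
qed

text \<open>A repeated index makes the form vanish, and any other index list can be sorted at the
  cost of a sign.\<close>

lemma alternating_form_increasing_eq_0:
  fixes x :: "nat \<Rightarrow> 'a"
  assumes alt: "alternating_form \<phi>" and span: "span (x ` S) = UNIV"
    and inc: "\<And>I. sorted_wrt (<) I \<Longrightarrow> set I \<subseteq> S \<Longrightarrow> \<phi> (map x I) = 0"
  shows "\<phi> vs = 0"
proof (rule alternating_form_span_eq_0[OF alt span])
  fix bs assume "set bs \<subseteq> x ` S"
  then have "bs \<in> lists (x ` S)" by auto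
  then obtain I where I: "bs = map x I" "set I \<subseteq> S"
    unfolding lists_image by auto
  show "\<phi> bs = 0"
  proof (cases "distinct I")
    case True
    then have "\<phi> (map x (sort I)) = 0"
      using I by (intro inc) (auto simp: strict_sorted_iff)
    then show ?thesis
      using alternating_form_sort[OF alt, of "[]" x I] I by auto
  next
    case False
    then obtain J K L i where "I = J @ [i] @ K @ [i] @ L"
      using not_distinct_decomp by blast
    then show ?thesis
      using alt I by (simp add: alternating_form_def)
  qed
qed

section \<open>Sesquilinearity and definiteness of the inner product\<close>

lemma ip_add_left: "ip (x + y) z = ip x z + ip y z"
  by (metis ip_commute ip_add_right conjugate_dist_add)

lemma ip_scale_left: "ip (c *s x) y = conjugate c * ip x y"
  by (metis ip_commute ip_scale_right conjugate_dist_mul)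

lemma ip_zero_right [simp]: "ip x 0 = 0"
  using ip_scale_right[of x 0 0] by simp

lemma ip_zero_left [simp]: "ip 0 x = 0"
  using ip_scale_left[of 0 0 x] by simp

lemma ip_diff_right: "ip x (y - z) = ip x y - ip x z"
  using ip_add_right[of x "y - z" z] by simp

lemma ip_sum_right: "ip x (sum f A) = (\<Sum>a\<in>A. ip x (f a))"
  by (induction A rule: infinite_finite_induct) (simp_all add: ip_add_right)

lemma ip_self_eq_0_iff [simp]: "ip x x = 0 \<longleftrightarrow> x = 0"
  by (metis ip_pos ip_zero_right less_irrefl of_real_eq_0_iff)

lemma ip_orth_span:
  assumes "u \<in> span S" "\<And>s. s \<in> S \<Longrightarrow> ip s y = 0"
  shows "ip u y = 0"
  using assms(1)
  by (induction rule: span_induct_alt) (simp_all add: ip_add_left ip_scale_left assms(2))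

subsection \<open>Orthogonal projection\<close>

lemma orth_proj_unique:
  assumes "subspace W" "y \<in> W" "y' \<in> W"
    and "\<And>w. w \<in> W \<Longrightarrow> ip w (x - y) = 0" "\<And>w. w \<in> W \<Longrightarrow> ip w (x - y') = 0"
  shows "y = y'"
proof -
  have "y - y' \<in> W"
    using assms by (simp add: subspace_diff)
  \<comment> \<open>The second argument equals \<open>y - y'\<close>, which is therefore orthogonal
    to itself.\<close>
  then have "ip (y - y') ((x - y') - (x - y)) = 0"
    by (subst ip_diff_right) (simp add: assms(4,5))
  then show ?thesis by simp
qed

text \<open>One Gram-Schmidt step per vector: the part \<open>u\<close> of \<open>b\<close>
  orthogonal to \<open>span S\<close> supplies a correction along \<open>u\<close>. The induction
  hypothesis serves both \<open>b\<close> and \<open>x\<close>.\<close>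

lemma orth_proj_exists:
  assumes "finite S"
  shows "\<exists>y\<in>span S. \<forall>w\<in>span S. ip w (x - y) = 0"
  using assms
proof (induction S arbitrary: x)
  case (insert b S)
  obtain b' where b': "b' \<in> span S" "\<And>w. w \<in> span S \<Longrightarrow> ip w (b - b') = 0"
    using insert.IH by blast
  obtain y where y: "y \<in> span S" "\<And>w. w \<in> span S \<Longrightarrow> ip w (x - y) = 0"
    using insert.IH by blast
  define u where "u = b - b'"
  \<comment> \<open>If \<open>b\<close> already lies in \<open>span S\<close>, then
    \<open>u = 0\<close> and the correction vanishes.\<close>
  define z where "z = y + (ip u x / ip u u) *s u"
  have sub: "span S \<subseteq> span (insert b S)"
    by (intro span_mono) auto
  have u: "u \<in> span (insert b S)"
    using b' sub by (auto simp: u_def intro: span_diff span_base)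
  have uy: "ip u y = 0"
    using b'(2)[OF y(1)] by (metis ip_commute conjugate_zero u_def)
  have orth_u: "ip u (x - z) = 0"
    by (cases "u = 0") (simp_all add: z_def ip_diff_right ip_add_right ip_scale_right uy)
  have orth_S: "ip w (x - z) = 0" if "w \<in> span S" for w
  proof -
    have "ip w u = 0"
      using b'(2)[OF that] by (simp add: u_def)
    then show ?thesis
      using y(2)[OF that] by (simp add: z_def ip_diff_right ip_add_right ip_scale_right)
  qed
  have "ip w (x - z) = 0" if "w \<in> span (insert b S)" for w
  proof (rule ip_orth_span[OF that])
    fix s assume "s \<in> insert b S"
    moreover have "ip b (x - z) = 0"
      using orth_u orth_S[OF b'(1)] ip_add_left[of u b' "x - z"] by (simp add: u_def)
    ultimately show "ip s (x - z) = 0"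
      using orth_S span_base by auto
  qed
  moreover have "z \<in> span (insert b S)"
    using y(1) sub u by (auto simp: z_def intro: span_add span_scale)
  ultimately show ?case by blast
qed auto

lemma
  assumes "finite S"
  shows orth_proj_in: "orth_proj (span S) x \<in> span S"
    and orth_proj_orth: "w \<in> span S \<Longrightarrow> ip w (x - orth_proj (span S) x) = 0"
proof -
  have "\<exists>!y. y \<in> span S \<and> (\<forall>w\<in>span S. ip w (x - y) = 0)"
    using orth_proj_exists[OF assms, of x] orth_proj_unique[OF subspace_span] by blast
  from theI'[OF this] show "orth_proj (span S) x \<in> span S"
    and "w \<in> span S \<Longrightarrow> ip w (x - orth_proj (span S) x) = 0"
    by (auto simp: orth_proj_def)
qed

text \<open>Sums and multiples of projections satisfy the characterising conditions, so uniqueness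
  applies.\<close>

lemma linear_orth_proj:
  assumes "finite S"
  shows "Vector_Spaces.linear scale scale (orth_proj (span S))"
proof -
  let ?P = "orth_proj (span S)"
  note in_S = orth_proj_in[OF assms] and orth = orth_proj_orth[OF assms]
  have "?P (x + y) = ?P x + ?P y" for x y
  proof (rule orth_proj_unique[OF subspace_span[of S], where x = "x + y"])
    fix w assume w: "w \<in> span S"
    have "x + y - (?P x + ?P y) = (x - ?P x) + (y - ?P y)" by simp
    then show "ip w (x + y - (?P x + ?P y)) = 0"
      using orth[OF w, of x] orth[OF w, of y] by (simp only: ip_add_right add_0)
  qed (auto intro: in_S orth span_add)
  moreover have "?P (c *s x) = c *s ?P x" for c x
  proof (rule orth_proj_unique[OF subspace_span[of S], where x = "c *s x"])
    fix w assume w: "w \<in> span S"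
    show "ip w (c *s x - c *s ?P x) = 0"
      using orth[OF w, of x] by (simp add: ip_scale_right flip: scale_right_diff_distrib)
  qed (auto intro: in_S orth span_scale)
  ultimately show ?thesis
    by (simp add: Vector_Spaces.linear_iff vector_space_axioms)
qed

text \<open>A vector and its projection have the same inner products with the elements of
  \<open>span S\<close>, so the two matrices agree entrywise.\<close>

lemma gram_orth_proj:
  assumes "set zs \<subseteq> span S" "finite S"
  shows "gram zs (map (orth_proj (span S)) vs) = gram zs vs"
proof -
  have "ip z (orth_proj (span S) v) = ip z v" if "z \<in> span S" for z v
    using orth_proj_orth[OF assms(2) that, of v] by (simp add: ip_diff_right)
  then show ?thesis
    using assms(1) unfolding gram_def
    by (auto intro!: arg_cong[of _ _ det] eq_matI simp: subset_iff)
qed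

subsection \<open>Gram determinants\<close>

text \<open>Coefficients are indexed by position rather than by vector, so that they can form the
  columns of a matrix.\<close>

lemma span_list:
  assumes "v \<in> span (set vs)"
  shows "\<exists>a. v = (\<Sum>i<length vs. a i *s vs ! i)"
  using assms
proof (induction rule: span_induct_alt)
  case base
  show ?case by (rule exI[of _ "\<lambda>_. 0"]) simp
next
  case (step c b y)
  then obtain a where a: "y = (\<Sum>i<length vs. a i *s vs ! i)" by blast
  obtain k where k: "k < length vs" "b = vs ! k"
    using step by (metis in_set_conv_nth)
  have "c *s b + y = (\<Sum>i<length vs. (if i = k then c *s vs ! i else 0) + a i *s vs ! i)"
    using k a by (simp add: sum.distrib)
  also have "\<dots> = (\<Sum>i<length vs. ((if i = k then c else 0) + a i) *s vs ! i)"
    by (intro sum.cong) (auto simp: scale_left_distrib)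
  finally show ?case
    by (intro exI[of _ "\<lambda>i. (if i = k then c else 0) + a i"])
qed

text \<open>The matrix for \<open>us\<close> is the one for \<open>vs\<close> times the square
  coefficient matrix, whose determinant is \<open>d\<close>. As \<open>d\<close> is fixed before
  \<open>zs\<close>, the wedge of \<open>us\<close> behaves as \<open>d\<close> times that of
  \<open>vs\<close> under every pairing.\<close>

lemma gram_span:
  assumes "length us = length vs" "set us \<subseteq> span (set vs)"
  obtains d where "\<And>zs. gram zs us = d * gram zs vs"
proof -
  let ?p = "length vs"
  have "\<forall>j<?p. \<exists>a. us ! j = (\<Sum>i<?p. a i *s vs ! i)"
    using assms span_list by (metis nth_mem subsetD)
  then obtain a where a: "\<And>j. j < ?p \<Longrightarrow> us ! j = (\<Sum>i<?p. a j i *s vs ! i)"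
    by metis
  let ?A = "mat ?p ?p (\<lambda>(i, j). a j i)"
  have "gram zs us = det ?A * gram zs vs" for zs
  proof (cases "length zs = ?p")
    case True
    have "mat ?p ?p (\<lambda>(i, j). ip (zs ! i) (us ! j)) = mat ?p ?p (\<lambda>(i, j). ip (zs ! i) (vs ! j)) * ?A"
      by (rule eq_matI)
        (auto simp: a ip_sum_right ip_scale_right scalar_prod_def mult.commute atLeast0LessThan intro!: sum.cong)
    then show ?thesis
      using True assms by (simp add: gram_def det_mult[of _ ?p])
  qed (use assms in \<open>simp add: gram_def\<close>)
  then show thesis by (rule that)
qed

text \<open>A kernel vector of the Gram matrix yields a combination \<open>u\<close> of
  \<open>vs\<close> orthogonal to all of \<open>vs\<close>, hence to itself; then
  \<open>u = 0\<close> contradicts independence.\<close>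

lemma gram_self_nonzero:
  assumes "distinct vs" "independent (set vs)"
  shows "gram vs vs \<noteq> 0"
proof
  assume "gram vs vs = 0"
  let ?p = "length vs"
  let ?M = "mat ?p ?p (\<lambda>(i, j). ip (vs ! i) (vs ! j))"
  have "det ?M = 0"
    using \<open>gram vs vs = 0\<close> by (simp add: gram_def)
  then obtain c where c: "c \<in> carrier_vec ?p" "c \<noteq> 0\<^sub>v ?p" "?M *\<^sub>v c = 0\<^sub>v ?p"
    using det_0_iff_vec_prod_zero_field[of ?M ?p] by auto
  define u where "u = (\<Sum>j<?p. c $ j *s vs ! j)"
  have "ip (vs ! i) u = 0" if "i < ?p" for i
  proof -
    have "(?M *\<^sub>v c) $ i = 0"
      using c that by simp
    then show ?thesis
      using that c(1) by (simp add: u_def ip_sum_right ip_scale_right scalar_prod_def mult.commute atLeast0LessThan)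
  qed
  then have "ip v u = 0" if "v \<in> set vs" for v
    using that by (metis in_set_conv_nth)
  moreover have "u \<in> span (set vs)"
    unfolding u_def by (intro span_sum span_scale span_base) auto
  ultimately have "u = 0"
    using ip_orth_span[of u "set vs" u] by simp
  have bij: "bij_betw ((!) vs) {..<?p} (set vs)"
    using assms(1) by (rule bij_betw_nth) auto
  \<comment> \<open>Distinctness lets the coefficients pass from positions to vectors, as
    \<open>independentD\<close> expects.\<close>
  define g where "g v = c $ (the_inv_into {..<?p} ((!) vs) v)" for v
  have g: "g (vs ! j) = c $ j" if "j < ?p" for j
    using that bij unfolding g_def bij_betw_def by (subst the_inv_into_f_f) auto
  have "(\<Sum>v\<in>set vs. g v *s v) = u"
    unfolding u_def by (rule sum.reindex_bij_betw[OF bij, symmetric, THEN trans]) (simp add: g)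
  then have "g v = 0" if "v \<in> set vs" for v
    using independentD[OF assms(2), of "set vs" g v] that \<open>u = 0\<close> by simp
  then have "c = 0\<^sub>v ?p"
    using c(1) g by (intro eq_vecI) (metis carrier_vecD index_zero_vec nth_mem)+
  then show False
    using c by simp
qed

subsection \<open>Blades\<close>

text \<open>The coefficient covers both shapes in \<open>represents\<close>: wedges with
  \<open>c = 1\<close>, scalars with the empty list.\<close>

definition blade :: "'k \<Rightarrow> 'a list \<Rightarrow> ('k, 'a) multivector" where
  "blade c vs = multivector_of (Poly_Mapping.single vs c)"

lemma mv_ip_blade: "mv_ip (blade c vs) (blade d ws) = conjugate c * d * gram vs ws"
  by (simp add: blade_def mv_ip_multivector_of combination_ip_def)

lemma mv_map_blade:
  "Vector_Spaces.linear scale scale T \<Longrightarrow> mv_map T (blade c vs) = blade c (map T vs)"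
  by (simp add: blade_def mv_map_multivector_of combination_map_single)

lemma wedge_eq_mv_zero_iff: "wedge vs = mv_zero \<longleftrightarrow> Poly_Mapping.single vs 1 \<in> wedge_relations"
  by (simp add: wedge_def mv_zero_def multivector_of_eq_iff)

text \<open>Expanding \<open>v\<close> by linearity produces only wedges with a repeated
  entry.\<close>

lemma wedge_in_span_eq_zero:
  assumes "v \<in> span (set us \<union> set ws)"
  shows "wedge (us @ v # ws) = mv_zero"
  using assms
proof (induction rule: span_induct_alt)
  case base
  show ?case
    using wedge_relations.homogeneous[of us 0 0 ws] by (simp add: wedge_eq_mv_zero_iff)
next
  case (step c b y)
  let ?s = "\<lambda>v. Poly_Mapping.single (us @ v # ws) (1::'k)"
  have "?s b \<in> wedge_relations"
  proof -
    consider "b \<in> set us" | "b \<in> set ws"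
      using step by blast
    then show ?thesis
      by cases (auto dest!: split_list intro: wedge_relations.alternating[of _ _ "_ :: 'a list"]
          wedge_relations.alternating[of us b])
  qed
  then have "Poly_Mapping.map ((*) c) (?s b) \<in> wedge_relations"
    by (rule wedge_relations.scale)
  also have "Poly_Mapping.map ((*) c) (?s b) = Poly_Mapping.single (us @ b # ws) c"
    by (rule poly_mapping_eqI) (simp add: map_mult_lookup lookup_single when_def)
  finally have "?s (c *s b) \<in> wedge_relations"
    using wedge_relations.add[OF wedge_relations.homogeneous[of us c b ws]] by force
  then have sum: "?s (c *s b) + ?s y \<in> wedge_relations"
    using step by (intro wedge_relations.add) (simp_all add: wedge_eq_mv_zero_iff)
  show ?case
    using wedge_relations.add[OF wedge_relations.additive[of us "c *s b" y ws] sum]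
    by (simp add: wedge_eq_mv_zero_iff)
qed

lemma wedge_nonzero_independent:
  assumes "wedge vs \<noteq> mv_zero"
  shows "distinct vs" "independent (set vs)"
proof -
  show "distinct vs"
  proof (rule ccontr)
    assume "\<not> distinct vs"
    then obtain as bs cs v where "vs = as @ [v] @ bs @ [v] @ cs"
      using not_distinct_decomp by blast
    then show False
      using assms wedge_relations.alternating[of as v bs cs] by (simp add: wedge_eq_mv_zero_iff)
  qed
  show "independent (set vs)"
  proof
    assume "dependent (set vs)"
    then obtain v where v: "v \<in> set vs" "v \<in> span (set vs - {v})"
      unfolding dependent_def by blast
    then obtain us ws where vs: "vs = us @ v # ws"
      by (meson split_list)
    have "v \<in> span (set us \<union> set ws)"
      using v(2) span_mono[of "set vs - {v}" "set us \<union> set ws"] vs by auto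
    then show False
      using assms wedge_in_span_eq_zero vs by simp
  qed
qed

text \<open>A common normal form for wedges and scalars; in grade 0 the list is empty and spans
  \<open>{0}\<close>.\<close>

lemma represents_blade:
  assumes "represents \<nu> V"
  obtains c vs where "\<nu> = blade c vs" "c \<noteq> 0" "distinct vs" "independent (set vs)"
    "span (set vs) = V" "length vs = dim V"
proof -
  consider (wedge) vs where "\<nu> \<noteq> mv_zero" "\<nu> = wedge vs" "V = span (set vs)"
    | (scalar) c where "\<nu> \<noteq> mv_zero" "\<nu> = mv_scalar c" "V = {0}"
    using assms unfolding represents_def by blast
  then show thesis
  proof cases
    case wedge
    have "distinct vs" "independent (set vs)"
      using wedge wedge_nonzero_independent by auto
    then show thesis
      using wedge by (intro that[of 1 vs])
        (simp_all add: blade_def wedge_def dim_eq_card_independent distinct_card)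
  next
    case scalar
    have "c \<noteq> 0"
    proof
      assume "c = 0"
      then show False
        using scalar by (simp add: mv_scalar_def mv_zero_def)
    qed
    moreover have "dim {0} = 0"
      using dim_eq_card_independent[of "{}"] dim_span[of "{}"] by (simp add: independent_empty)
    ultimately show thesis
      using scalar by (intro that[of c "[]"]) (simp_all add: blade_def mv_scalar_def independent_empty)
  qed
qed

text \<open>Nonvanishing in the quotient is detected by the inner product: the Gram determinant of
  \<open>vs\<close> is nonzero, while \<open>mv_zero\<close> pairs to 0 with itself.\<close>

lemma represents_wedge:
  assumes "distinct vs" "independent (set vs)"
  shows "represents (wedge vs) (span (set vs))"
proof -
  have "gram vs vs \<noteq> 0"
    using assms by (rule gram_self_nonzero)
  then have "wedge vs \<noteq> mv_zero"
    using mv_ip_wedge[of vs vs] mv_ip_multivector_of[of 0 0]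
    by (auto simp: mv_zero_def combination_ip_def)
  moreover have "wedge [] = mv_scalar 1"
    by (simp add: wedge_def mv_scalar_def)
  ultimately show ?thesis
    unfolding represents_def by (cases "vs = []") auto
qed

text \<open>Expansion along the column of \<open>v\<close>, whose entries all vanish.\<close>

lemma gram_eq_0_orth:
  assumes "v \<in> set vs" "\<And>z. z \<in> set zs \<Longrightarrow> ip z v = 0"
  shows "gram zs vs = 0"
proof (cases "length zs = length vs")
  case True
  obtain us ws where vs: "vs = us @ v # ws"
    using assms(1) by (meson split_list)
  obtain K where "\<And>v. gram zs (us @ v # ws) = (\<Sum>i<length zs. ip (zs ! i) v * K i)"
    using gram_expand[of zs us ws] True vs by auto
  then show ?thesis
    using assms(2) vs by simp
qed (simp add: gram_def)

subsection \<open>Coordinate blades of an orthogonal basis\<close>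

text \<open>The Gram matrix is diagonal with positive entries. Since \<open>'k\<close> carries no
  order, positivity means being the image of a positive real.\<close>

lemma gram_orthogonal_self:
  assumes "distinct vs" "\<And>v w. v \<in> set vs \<Longrightarrow> w \<in> set vs \<Longrightarrow> v \<noteq> w \<Longrightarrow> ip v w = 0"
    and "0 \<notin> set vs"
  obtains r where "r > 0" "gram vs vs = of_real r"
proof -
  let ?p = "length vs"
  let ?M = "mat ?p ?p (\<lambda>(i, j). ip (vs ! i) (vs ! j))"
  have pos: "\<exists>r>0. prod_list (map f l) = (of_real r :: 'k)"
    if "\<And>i. i \<in> set l \<Longrightarrow> \<exists>r>0. f i = of_real r" for f :: "nat \<Rightarrow> 'k" and l
    using that
  proof (induction l)
    case Nil
    show ?case by (rule exI[of _ 1]) simp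
  next
    case (Cons i l)
    then obtain r s where "r > 0" "f i = of_real r" "s > 0" "prod_list (map f l) = of_real s"
      by (metis list.set_intros)
    then show ?case
      by (intro exI[of _ "r * s"]) simp
  qed
  have "gram vs vs = det ?M"
    by (simp add: gram_def)
  also have "\<dots> = prod_list (diag_mat ?M)"
    using assms by (intro det_upper_triangular[of _ ?p]) (auto simp: nth_eq_iff_index_eq)
  also have "\<dots> = prod_list (map (\<lambda>i. ip (vs ! i) (vs ! i)) [0..<?p])"
    unfolding diag_mat_def by (intro arg_cong[of _ _ prod_list] map_cong) auto
  finally have "gram vs vs = \<dots>" .
  moreover have "\<exists>r>0. ip (vs ! i) (vs ! i) = of_real r" if "i \<in> set [0..<?p]" for i
    using that assms(3) by (intro ip_pos) (auto simp: in_set_conv_nth)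
  ultimately show thesis
    using pos[of "[0..<?p]" "\<lambda>i. ip (vs ! i) (vs ! i)"] that by auto
qed

lemma multi_index_props:
  assumes "orthogonal_basis n x" "I \<in> multi_indices p n"
  shows "length I = p" "distinct (map x I)" "independent (set (map x I))"
proof -
  have I: "length I = p" "set I \<subseteq> {1..n}" "distinct I"
    using assms(2) by (auto simp: multi_indices_def strict_sorted_iff)
  show "length I = p" by fact
  show "distinct (map x I)"
    using assms(1) I by (auto simp: distinct_map orthogonal_basis_def intro: inj_on_subset)
  show "independent (set (map x I))"
    using assms(1) independent_mono[of "x ` {1..n}"] image_mono[OF I(2), of x]
    by (simp add: orthogonal_basis_def)
qed

lemma gram_coordinate_self:
  assumes "orthogonal_basis n x" "I \<in> multi_indices p n"
  obtains r where "r > 0" "gram (map x I) (map x I) = of_real r"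
proof (rule gram_orthogonal_self[of "map x I"])
  show "distinct (map x I)" "0 \<notin> set (map x I)"
    using multi_index_props[OF assms] dependent_zero by auto
  fix v w assume "v \<in> set (map x I)" "w \<in> set (map x I)" "v \<noteq> w"
  then obtain i j where "i \<in> set I" "j \<in> set I" "i \<noteq> j" "v = x i" "w = x j"
    by auto
  then show "ip v w = 0"
    using assms unfolding orthogonal_basis_def multi_indices_def by blast
qed (rule that)

text \<open>Different increasing lists of equal length have different index sets, so some
  \<open>x j\<close> from \<open>J\<close> is orthogonal to every vector from
  \<open>I\<close>.\<close>

lemma gram_coordinate_distinct:
  assumes "orthogonal_basis n x" "I \<in> multi_indices p n" "J \<in> multi_indices p n" "I \<noteq> J"
  shows "gram (map x I) (map x J) = 0"
proof -
  have I: "length I = p" "set I \<subseteq> {1..n}" "distinct I" "sorted I"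
    and J: "length J = p" "set J \<subseteq> {1..n}" "distinct J" "sorted J"
    using assms by (auto simp: multi_indices_def strict_sorted_iff)
  have "set I \<noteq> set J"
    using sorted_distinct_set_unique I J \<open>I \<noteq> J\<close> by blast
  moreover have "card (set I) = card (set J)"
    using I J by (simp add: distinct_card)
  ultimately have "\<not> set J \<subseteq> set I"
    by (metis List.finite_set card_subset_eq)
  then obtain j where j: "j \<in> set J" "j \<notin> set I"
    by blast
  have "ip (x i) (x j) = 0" if "i \<in> set I" for i
    using assms(1) that j I J unfolding orthogonal_basis_def by (metis subsetD)
  then show ?thesis
    using j by (intro gram_eq_0_orth[of "x j"]) auto
qed

lemma finite_multi_indices: "finite (multi_indices p n)"
  by (rule finite_subset[OF _ finite_lists_length_eq[of "{1..n}" p]]) (auto simp: multi_indices_def)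

text \<open>Cauchy--Binet: the difference of both sides is an alternating form in \<open>ws\<close>, and it vanishes
  on the coordinate blades.\<close>

lemma gram_parseval:
  assumes ob: "orthogonal_basis n x" and zs: "length zs = p"
  shows "gram zs ws = (\<Sum>I\<in>multi_indices p n.
    gram zs (map x I) * gram (map x I) ws / gram (map x I) (map x I))"
proof -
  let ?R = "\<lambda>ws. \<Sum>I\<in>multi_indices p n.
    gram zs (map x I) * gram (map x I) ws / gram (map x I) (map x I)"
  have "gram zs ws - ?R ws = 0"
  proof (rule alternating_form_increasing_eq_0[where \<phi> = "\<lambda>ws. gram zs ws - ?R ws"])
    show "alternating_form (\<lambda>ws. gram zs ws - ?R ws)"
      by (simp add: alternating_form_def gram_additive gram_homogeneous gram_alternating
          algebra_simps add_divide_distrib sum.distrib sum_distrib_left)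
    show "span (x ` {1..n}) = UNIV"
      using ob by (simp add: orthogonal_basis_def)
    fix J :: "nat list" assume J: "sorted_wrt (<) J" "set J \<subseteq> {1..n}"
    show "gram zs (map x J) - ?R (map x J) = 0"
    proof (cases "length J = p")
      case True
      then have J_in: "J \<in> multi_indices p n"
        using J by (simp add: multi_indices_def)
      \<comment> \<open>Orthogonality of the coordinate blades leaves only the term of
        \<open>J\<close>, where the Gram determinant cancels.\<close>
      have "?R (map x J) = (\<Sum>I\<in>multi_indices p n. if I = J then gram zs (map x J) else 0)"
      proof (rule sum.cong[OF refl])
        fix I assume I: "I \<in> multi_indices p n"
        have "gram (map x J) (map x J) \<noteq> 0"
          using gram_self_nonzero multi_index_props[OF ob J_in] by blast
        then show "gram zs (map x I) * gram (map x I) (map x J) / gram (map x I) (map x I) =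
            (if I = J then gram zs (map x J) else 0)"
          using gram_coordinate_distinct[OF ob I J_in] by simp
      qed
      then show ?thesis
        using J_in by (simp add: finite_multi_indices)
    next
      case False
      \<comment> \<open>In other grades both sides are 0, by the default value of
        \<open>gram\<close> on lists of different lengths.\<close>
      then have "gram zs (map x J) = 0" "\<And>I. I \<in> multi_indices p n \<Longrightarrow> gram (map x I) (map x J) = 0"
        using zs by (auto simp: gram_def multi_indices_def)
      then show ?thesis by simp
    qed
  qed
  then show ?thesis by simp
qed

end

subsection \<open>Cosines of Grassmann angles\<close>

text \<open>The two properties that distinguish \<^typ>\<open>real\<close> and \<^typ>\<open>complex\<close> among the scalar types
  admitted by \<^locale>\<open>inner_product_space\<close>, where \<^const>\<open>norm\<close> and \<^const>\<open>conjugate\<close> are unrelated.\<close>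

locale real_or_complex_inner_product_space = inner_product_space scale ip
  for scale :: "'k::{conjugatable_field,real_normed_field,banach} \<Rightarrow> 'a::ab_group_add \<Rightarrow> 'a"
    (infixr \<open>*s\<close> 75)
  and ip :: "'a \<Rightarrow> 'a \<Rightarrow> 'k" +
  assumes conjugate_mult_self: "conjugate c * (c :: 'k) = of_real ((norm c)\<^sup>2)"
    and cos_attains: "norm (q :: 'k) \<le> 1 \<Longrightarrow> \<exists>\<theta>. cos \<theta> = q"
begin

lemma norm_conjugate: "norm (conjugate c) = norm (c :: 'k)"
proof (cases "c = 0")
  case False
  have "norm (conjugate c) * norm c = (norm c)\<^sup>2"
    unfolding norm_mult[symmetric] conjugate_mult_self by (simp add: norm_power)
  then show ?thesis
    using False by (simp add: power2_eq_square)
qed simp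

lemma conjugate_of_real: "conjugate (of_real r :: 'k) = of_real r"
proof (cases "r = 0")
  case False
  have "conjugate (of_real r) * of_real r = (of_real r * of_real r :: 'k)"
    unfolding conjugate_mult_self by (simp add: power2_eq_square)
  then show ?thesis
    using False by simp
qed simp

lemma norm_gram_commute: "norm (gram vs ws) = norm (gram ws vs)"
  by (metis gram_commute norm_conjugate)

lemma gram_coordinate_self_norm:
  assumes "orthogonal_basis n x" "I \<in> multi_indices p n"
  shows "gram (map x I) (map x I) = of_real (norm (gram (map x I) (map x I)))"
  using gram_coordinate_self[OF assms] by (metis abs_of_pos norm_of_real)

text \<open>The diagonal case of \<open>gram_parseval\<close>: each summand is the image of a
  nonnegative real, so the norm passes through the sum. The squares are shaped for
  \<open>L2_set\<close>.\<close>

lemma norm_gram_self: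
  assumes ob: "orthogonal_basis n x" and vs: "length vs = p"
  shows "norm (gram vs vs) = (\<Sum>I\<in>multi_indices p n.
    (norm (gram vs (map x I)) / sqrt (norm (gram (map x I) (map x I))))\<^sup>2)"
proof -
  have "gram vs vs = (\<Sum>I\<in>multi_indices p n. of_real
    ((norm (gram vs (map x I)) / sqrt (norm (gram (map x I) (map x I))))\<^sup>2))"
    unfolding gram_parseval[OF assms, of vs]
  proof (rule sum.cong[OF refl])
    fix I assume I: "I \<in> multi_indices p n"
    have "gram vs (map x I) * gram (map x I) vs = of_real ((norm (gram vs (map x I)))\<^sup>2)"
      using conjugate_mult_self[of "gram vs (map x I)"] by (simp add: gram_commute[of _ vs] mult.commute)
    then show "gram vs (map x I) * gram (map x I) vs / gram (map x I) (map x I) =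
        of_real ((norm (gram vs (map x I)) / sqrt (norm (gram (map x I) (map x I))))\<^sup>2)"
      by (subst gram_coordinate_self_norm[OF ob I]) (simp add: power_divide)
  qed
  also have "\<dots> = of_real (\<Sum>I\<in>multi_indices p n.
    (norm (gram vs (map x I)) / sqrt (norm (gram (map x I) (map x I))))\<^sup>2)"
    by simp
  finally show ?thesis
    by (metis (no_types, lifting) norm_of_real abs_of_nonneg sum_nonneg zero_le_power2)
qed

text \<open>In normalised coordinates this is the real inequality for \<open>L2_set\<close>.\<close>

lemma gram_Cauchy_Schwarz:
  assumes ob: "orthogonal_basis n x" and len: "length vs = p" "length ws = p"
  shows "norm (gram vs ws) \<le> sqrt (norm (gram vs vs)) * sqrt (norm (gram ws ws))"
proof -
  let ?f = "\<lambda>vs I. norm (gram vs (map x I)) / sqrt (norm (gram (map x I) (map x I)))"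
  have "norm (gram vs ws) \<le> (\<Sum>I\<in>multi_indices p n. \<bar>?f vs I\<bar> * \<bar>?f ws I\<bar>)"
    unfolding gram_parseval[OF ob len(1), of ws]
  proof (rule sum_norm_le)
    fix I
    show "norm (gram vs (map x I) * gram (map x I) ws / gram (map x I) (map x I)) \<le> \<bar>?f vs I\<bar> * \<bar>?f ws I\<bar>"
      by (simp add: norm_mult norm_divide norm_gram_commute[of "map x I" ws])
  qed
  also have "\<dots> \<le> L2_set (?f vs) (multi_indices p n) * L2_set (?f ws) (multi_indices p n)"
    by (rule L2_set_mult_ineq)
  finally show ?thesis
    by (simp add: L2_set_def norm_gram_self[OF ob len(1)] norm_gram_self[OF ob len(2)])
qed

lemma mv_norm_blade: "mv_norm (blade c vs) = norm c * sqrt (norm (gram vs vs))"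
  by (simp add: mv_norm_def mv_ip_blade norm_mult norm_conjugate real_sqrt_mult)

text \<open>The factor comes out once from each argument, from the first by
  \<open>norm_gram_commute\<close>.\<close>

lemma norm_gram_scaled:
  assumes "\<And>zs. gram zs us = d * gram zs vs"
  shows "norm (gram us us) = (norm d)\<^sup>2 * norm (gram vs vs)"
  using assms[of us] assms[of vs] norm_gram_commute[of us vs]
  by (simp add: norm_mult power2_eq_square)

lemma mv_norm_proj_blade:
  assumes "length vs = length ws" "gram ws ws \<noteq> 0"
  shows "mv_norm (mv_map (orth_proj (span (set ws))) (blade c vs)) =
    norm c * norm (gram vs ws) / sqrt (norm (gram ws ws))"
proof -
  let ?P = "orth_proj (span (set ws))"
  \<comment> \<open>The projected list lies in the span of \<open>ws\<close> and has the same
    length, so it acts as a multiple \<open>d\<close> of \<open>ws\<close>; pairing with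
    \<open>ws\<close> itself then determines \<open>norm d\<close>.\<close>
  obtain d where d: "\<And>zs. gram zs (map ?P vs) = d * gram zs ws"
    by (rule gram_span[of "map ?P vs" ws]) (use assms orth_proj_in in auto)
  have "gram ws vs = d * gram ws ws"
    using d[of ws] gram_orth_proj[of ws "set ws" vs] span_superset by simp
  then have "norm d = norm (gram vs ws) / norm (gram ws ws)"
    using assms by (simp add: norm_gram_commute[of vs ws] norm_mult)
  then have "norm d * sqrt (norm (gram ws ws)) = norm (gram vs ws) / sqrt (norm (gram ws ws))"
    by (simp add: divide_simps mult.assoc)
  then have "sqrt (norm (gram (map ?P vs) (map ?P vs))) = norm (gram vs ws) / sqrt (norm (gram ws ws))"
    by (simp add: norm_gram_scaled[OF d] real_sqrt_mult)
  then show ?thesis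
    by (simp add: mv_map_blade linear_orth_proj mv_norm_blade)
qed

lemma cos_grassmann_angle:
  assumes ob: "orthogonal_basis n x"
    and vs: "distinct vs" "independent (set vs)" and ws: "distinct ws" "independent (set ws)"
    and len: "length vs = length ws"
  shows "cos (grassmann_angle (span (set vs)) (span (set ws))) =
    norm (gram vs ws) / (sqrt (norm (gram vs vs)) * sqrt (norm (gram ws ws)))" (is "_ = ?q")
proof -
  let ?V = "span (set vs)" and ?W = "span (set ws)"
  have nz: "gram vs vs \<noteq> 0" "gram ws ws \<noteq> 0"
    using gram_self_nonzero vs ws by auto
  \<comment> \<open>Any other blade representing the same subspace scales numerator and denominator
    by the same factor.\<close>
  have ratio: "mv_norm (mv_map (orth_proj ?W) \<nu>) / mv_norm \<nu> = ?q" if rep: "represents \<nu> ?V" for \<nu>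
  proof -
    obtain c us where us: "\<nu> = blade c us" "c \<noteq> 0" "distinct us" "independent (set us)"
      "span (set us) = ?V" "length us = dim ?V"
      by (rule represents_blade[OF rep])
    have len': "length us = length vs"
      using us vs by (simp add: dim_eq_card_independent distinct_card)
    obtain d where d: "\<And>zs. gram zs us = d * gram zs vs"
      by (rule gram_span[OF len']) (use us span_superset in auto)
    have "d \<noteq> 0"
      using d[of us] gram_self_nonzero[OF us(3,4)] by auto
    have "norm (gram us ws) = norm d * norm (gram vs ws)"
      using d[of ws] by (simp add: norm_gram_commute[of _ ws] norm_mult)
    then show ?thesis
      using \<open>d \<noteq> 0\<close> us(2) len len' nz unfolding us(1)
      by (simp add: mv_norm_proj_blade mv_norm_blade norm_gram_scaled[OF d] real_sqrt_mult)
  qed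
  \<comment> \<open>Cauchy-Schwarz puts \<open>?q\<close> into the range where \<open>arccos\<close>
    inverts the cosine.\<close>
  have "?q \<le> 1"
    using gram_Cauchy_Schwarz[OF ob refl len[symmetric]] nz by (simp add: divide_le_eq)
  moreover have "0 \<le> ?q"
    by simp
  ultimately have q: "0 \<le> arccos ?q" "arccos ?q \<le> pi / 2" "cos (arccos ?q) = ?q"
    by (intro arccos_lbound arccos_le_pi2 cos_arccos; linarith)+
  have "grassmann_angle ?V ?W = arccos ?q"
    unfolding grassmann_angle_def
  proof (rule the_equality)
    show "0 \<le> arccos ?q \<and> arccos ?q \<le> pi / 2 \<and>
      (\<forall>\<nu>. represents \<nu> ?V \<longrightarrow> cos (arccos ?q) = mv_norm (mv_map (orth_proj ?W) \<nu>) / mv_norm \<nu>)"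
      using q ratio by simp
    fix \<theta> assume \<theta>: "0 \<le> \<theta> \<and> \<theta> \<le> pi / 2 \<and>
      (\<forall>\<nu>. represents \<nu> ?V \<longrightarrow> cos \<theta> = mv_norm (mv_map (orth_proj ?W) \<nu>) / mv_norm \<nu>)"
    \<comment> \<open>The wedge of \<open>vs\<close> is a blade at which the universal condition can
      be evaluated, so it is not vacuous.\<close>
    have "cos \<theta> = ?q"
      using \<theta> ratio[OF represents_wedge[OF vs]] represents_wedge[OF vs] by auto
    moreover have "\<theta> \<le> pi"
      using \<theta> pi_ge_zero by linarith
    ultimately show "\<theta> = arccos ?q"
      using \<theta> arccos_cos[of \<theta>] by simp
  qed
  then show ?thesis
    using q by simp
qed

text \<open>The phase of the inner product times its modulus restores the inner product, divided by
  the two norms.\<close>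

lemma cos_oriented_angle:
  assumes ob: "orthogonal_basis n x" and S: "oriented_subspace p S" and T: "oriented_subspace p T"
  shows "cos (oriented_angle S T) =
    mv_ip (snd S) (snd T) / of_real (mv_norm (snd S) * mv_norm (snd T))"
proof -
  obtain V \<nu> W \<omega> where ST: "S = (V, \<nu>)" "T = (W, \<omega>)"
    by fastforce
  obtain c vs where vs: "\<nu> = blade c vs" "c \<noteq> 0" "distinct vs" "independent (set vs)"
      "span (set vs) = V" "length vs = dim V"
    using S ST by (auto simp: oriented_subspace_def elim: represents_blade)
  obtain d ws where ws: "\<omega> = blade d ws" "d \<noteq> 0" "distinct ws" "independent (set ws)"
      "span (set ws) = W" "length ws = dim W"
    using T ST by (auto simp: oriented_subspace_def elim: represents_blade)
  have len: "length vs = length ws"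
    using vs ws S T ST by (simp add: oriented_subspace_def)
  have nz: "gram vs vs \<noteq> 0" "gram ws ws \<noteq> 0"
    using gram_self_nonzero vs ws by auto
  let ?a = "mv_ip \<nu> \<omega>"
  have cosG: "cos (grassmann_angle V W) = norm ?a / (mv_norm \<nu> * mv_norm \<omega>)"
    using cos_grassmann_angle[OF ob vs(3,4) ws(3,4) len] vs(2) ws(2)
    by (simp add: vs(5) ws(5) mv_norm_blade mv_ip_blade norm_mult norm_conjugate vs(1) ws(1))
  show ?thesis
  proof (cases "?a = 0")
    case True
    \<comment> \<open>The default angle \<open>pi / 2\<close> has cosine 0, matching the vanishing
      numerator.\<close>
    then show ?thesis
      by (simp add: oriented_angle_def ST cos_of_real)
  next
    case False
    let ?q = "?a / of_real (norm ?a) * of_real (cos (grassmann_angle V W))"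
    \<comment> \<open>The first factor has norm 1 and the second is a real cosine; hence
      \<open>SOME\<close> has a witness.\<close>
    have "norm ?q \<le> 1"
      using False by (simp add: norm_mult norm_divide)
    then have "\<exists>\<theta>. cos \<theta> = ?q"
      by (rule cos_attains)
    from someI_ex[OF this] have "cos (oriented_angle S T) = ?q"
      using False by (simp add: oriented_angle_def ST)
    also have "\<dots> = ?a / of_real (mv_norm \<nu> * mv_norm \<omega>)"
      using False unfolding cosG by simp
    finally show ?thesis
      by (simp add: ST)
  qed
qed

lemma oriented_coordinate_subspace:
  assumes "orthogonal_basis n x" "I \<in> multi_indices p n"
  shows "oriented_subspace p (coordinate_subspace x I)"
  using multi_index_props[OF assms] represents_wedge[of "map x I"]
  by (simp add: oriented_subspace_def coordinate_subspace_def subspace_span dim_eq_card_independent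
      distinct_card[of "map x I", simplified])

text \<open>Conjugation reverses the pairing of \<open>W\<close> with the coordinate blade, which
  turns the sum into \<open>gram_parseval\<close> divided by the norms of the two blades.\<close>

theorem cos_oriented_angle_sum:
  assumes ob: "orthogonal_basis n x" and V: "oriented_subspace p V" and W: "oriented_subspace p W"
  shows "cos (oriented_angle V W) = (\<Sum>I\<in>multi_indices p n.
    cos (oriented_angle V (coordinate_subspace x I)) *
    conjugate (cos (oriented_angle W (coordinate_subspace x I))))"
proof -
  obtain c vs where vs: "snd V = blade c vs" "length vs = p"
    using V by (auto simp: oriented_subspace_def elim: represents_blade)
  obtain d ws where ws: "snd W = blade d ws" "length ws = p"
    using W by (auto simp: oriented_subspace_def elim: represents_blade)
  let ?N = "mv_norm (snd V) * mv_norm (snd W)"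
  have summand: "cos (oriented_angle V (coordinate_subspace x I)) *
      conjugate (cos (oriented_angle W (coordinate_subspace x I))) =
      conjugate c * d * (gram vs (map x I) * gram (map x I) ws / gram (map x I) (map x I)) / of_real ?N"
    if I: "I \<in> multi_indices p n" for I
  proof -
    let ?e = "blade 1 (map x I)"
    have snd: "snd (coordinate_subspace x I) = ?e"
      by (simp add: coordinate_subspace_def blade_def wedge_def)
    have cosV: "cos (oriented_angle V (coordinate_subspace x I)) =
        conjugate c * gram vs (map x I) / of_real (mv_norm (snd V) * mv_norm ?e)"
      using cos_oriented_angle[OF ob V oriented_coordinate_subspace[OF ob I]]
      by (simp add: snd vs(1) mv_ip_blade)
    \<comment> \<open>Written as a conjugate so that the conjugation in the summand cancels
      it.\<close>
    have "mv_ip (snd W) ?e = conjugate (d * gram (map x I) ws)"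
      by (simp add: ws(1) mv_ip_blade conjugate_dist_mul flip: gram_commute)
    then have "cos (oriented_angle W (coordinate_subspace x I)) =
        conjugate (d * gram (map x I) ws / of_real (mv_norm (snd W) * mv_norm ?e))"
      using cos_oriented_angle[OF ob W oriented_coordinate_subspace[OF ob I]]
      by (simp only: snd divide_inverse conjugate_dist_mul conjugate_of_real flip: of_real_inverse)
    \<comment> \<open>The two norms of the coordinate blade multiply to the denominator in
      \<open>gram_parseval\<close>.\<close>
    moreover have "of_real (mv_norm ?e * mv_norm ?e) = gram (map x I) (map x I)"
      using gram_coordinate_self_norm[OF ob I] by (simp add: mv_norm_blade flip: of_real_mult)
    ultimately show ?thesis
      unfolding cosV by (simp add: mult_ac flip: \<open>_ = gram (map x I) (map x I)\<close>)
  qed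
  have "cos (oriented_angle V W) = conjugate c * d * gram vs ws / of_real ?N"
    unfolding cos_oriented_angle[OF ob V W] by (simp add: vs(1) ws(1) mv_ip_blade)
  also have "\<dots> = (\<Sum>I\<in>multi_indices p n.
      conjugate c * d * (gram vs (map x I) * gram (map x I) ws / gram (map x I) (map x I)) / of_real ?N)"
    unfolding gram_parseval[OF ob vs(2), of ws] by (simp add: sum_distrib_left sum_divide_distrib)
  finally show ?thesis
    by (simp add: summand)
qed

end

section \<open>Specialisation to real and complex scalars\<close>

theorem theorem5p1:
  fixes scR :: "real \<Rightarrow> 'a::ab_group_add \<Rightarrow> 'a" and ipR :: "'a \<Rightarrow> 'a \<Rightarrow> real"
    and scC :: "complex \<Rightarrow> 'b::ab_group_add \<Rightarrow> 'b" and ipC :: "'b \<Rightarrow> 'b \<Rightarrow> complex"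
  shows
    "(inner_product_space scR ipR \<longrightarrow>
       (\<forall>n p V W x.
          n = vector_space.dim scR (UNIV :: 'a set) \<and>
          inner_product_space.oriented_subspace scR p V \<and>
          inner_product_space.oriented_subspace scR p W \<and>
          inner_product_space.orthogonal_basis scR ipR n x \<longrightarrow>
          cos (inner_product_space.oriented_angle scR ipR V W) =
            (\<Sum>I\<in>multi_indices p n.
               cos (inner_product_space.oriented_angle scR ipR V
                      (inner_product_space.coordinate_subspace scR x I)) *
               cos (inner_product_space.oriented_angle scR ipR W
                      (inner_product_space.coordinate_subspace scR x I)))))
     \<and>
     (inner_product_space scC ipC \<longrightarrow>
       (\<forall>n p V W x.
          n = vector_space.dim scC (UNIV :: 'b set) \<and>
          inner_product_space.oriented_subspace scC p V \<and>
          inner_product_space.oriented_subspace scC p W \<and>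
          inner_product_space.orthogonal_basis scC ipC n x \<longrightarrow>
          cos (inner_product_space.oriented_angle scC ipC V W) =
            (\<Sum>I\<in>multi_indices p n.
               cos (inner_product_space.oriented_angle scC ipC V
                      (inner_product_space.coordinate_subspace scC x I)) *
               cnj (cos (inner_product_space.oriented_angle scC ipC W
                      (inner_product_space.coordinate_subspace scC x I))))))"
proof (intro conjI impI allI; elim conjE)
  assume "inner_product_space scR ipR"
  then interpret inner_product_space scR ipR .
  interpret real_or_complex_inner_product_space scR ipR
  proof
    show "\<exists>\<theta>. cos \<theta> = q" if "norm q \<le> 1" for q :: real
      using that by (intro exI[of _ "arccos q"]) (simp add: cos_arccos_abs)
  qed (simp add: power2_eq_square)
  fix n p V W x
  assume "oriented_subspace p V" "oriented_subspace p W" "orthogonal_basis n x"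
  then show "cos (oriented_angle V W) = (\<Sum>I\<in>multi_indices p n.
      cos (oriented_angle V (coordinate_subspace x I)) *
      cos (oriented_angle W (coordinate_subspace x I)))"
    using cos_oriented_angle_sum by simp
next
  assume "inner_product_space scC ipC"
  then interpret inner_product_space scC ipC .
  interpret real_or_complex_inner_product_space scC ipC
  proof
    \<comment> \<open>The complex cosine is surjective, with right inverse
      \<open>Arccos\<close>.\<close>
    show "\<exists>\<theta>. cos \<theta> = q" for q :: complex
      using cos_Arccos by blast
  qed (simp add: complex_norm_square mult.commute del: of_real_power)
  fix n p V W x
  assume "oriented_subspace p V" "oriented_subspace p W" "orthogonal_basis n x"
  then show "cos (oriented_angle V W) = (\<Sum>I\<in>multi_indices p n.
      cos (oriented_angle V (coordinate_subspace x I)) *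
      cnj (cos (oriented_angle W (coordinate_subspace x I))))"
    using cos_oriented_angle_sum by simp
qed

end
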